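(* Let $t\ge 2$ be an integer and let $\gamma>0$ be real. Then there exists $d=d(\gamma,t)$ such that for all positive integers $m,n$, every $m\times n$ Boolean matrix $M$ with no $t\times t$ all-ones submatrix and with $\gamma_2(M)\le\gamma$ contains at most $d(m+n)$ one entries.
   Context: A Boolean matrix is a matrix with entries in $\{0,1\}$. A submatrix is obtained by choosing an arbitrary subset of the rows and an arbitrary subset of the columns. For a real $m\times n$ matrix $M$, $\gamma_2(M)=\min_{UV=M}\|U\|_{\mathrm{row}}\|V\|_{\mathrm{col}}$, where the minimum is over all factorizations of $M$ as a product $UV$ of real matrices, $\|U\|_{\mathrm{row}}$ is the maximum $\ell_2$-norm of a row of $U$, and $\|V\|_{\mathrm{col}}$ is the maximum $\ell_2$-norm of a column of $V$. *)

theory Defs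
  imports "Jordan_Normal_Form.Matrix" "Jordan_Normal_Form.DL_Submatrix" "HOL-Analysis.L2_Norm"
begin

definition boolean_mat :: "real mat \<Rightarrow> bool" where
  "boolean_mat M \<longleftrightarrow> elements_mat M \<subseteq> {0, 1}"

definition ones_mat :: "nat \<Rightarrow> nat \<Rightarrow> real mat" where
  "ones_mat p q = mat p q (\<lambda>_. 1)"

definition has_ones_submatrix :: "nat \<Rightarrow> real mat \<Rightarrow> bool" where
  "has_ones_submatrix t M \<longleftrightarrow>
     (\<exists>I J. I \<subseteq> {..<dim_row M} \<and> J \<subseteq> {..<dim_col M} \<and> submatrix M I J = ones_mat t t)"

definition num_ones :: "real mat \<Rightarrow> nat" where
  "num_ones M = card {(i, j). i < dim_row M \<and> j < dim_col M \<and> M $$ (i, j) = 1}"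

text \<open>The next two norms are meaningful only for matrices with at least one row, respectively
  at least one column, since \<open>Max {}\<close> is unspecified.\<close>

definition row_norm :: "real mat \<Rightarrow> real" where
  "row_norm U = Max ((\<lambda>i. L2_set (\<lambda>k. U $$ (i, k)) {..<dim_col U}) ` {..<dim_row U})"

definition col_norm :: "real mat \<Rightarrow> real" where
  "col_norm V = Max ((\<lambda>j. L2_set (\<lambda>k. V $$ (k, j)) {..<dim_row V}) ` {..<dim_col V})"

text \<open>The inner dimension \<open>k\<close> of the factorization is unrestricted, so the minimum is written as an
  infimum of reals; for matrices with positive dimensions the set is nonempty and bounded below
  (see the lemmas following the definition), and the infimum is attained.\<close>

definition gamma2 :: "real mat \<Rightarrow> real" where
  "gamma2 M = Inf {row_norm U * col_norm V | U V k.
     U \<in> carrier_mat (dim_row M) k \<and> V \<in> carrier_mat k (dim_col M) \<and> U * V = M}"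

lemma row_norm_nonneg:
  assumes "0 < dim_row U"
  shows "0 \<le> row_norm U"
proof -
  have "L2_set (\<lambda>k. U $$ (0, k)) {..<dim_col U} \<le> row_norm U"
    unfolding row_norm_def using assms by (intro Max_ge finite_imageI imageI) simp_all
  with L2_set_nonneg show ?thesis by (rule order_trans)
qed

lemma col_norm_nonneg:
  assumes "0 < dim_col V"
  shows "0 \<le> col_norm V"
proof -
  have "L2_set (\<lambda>k. V $$ (k, 0)) {..<dim_row V} \<le> col_norm V"
    unfolding col_norm_def using assms by (intro Max_ge finite_imageI imageI) simp_all
  with L2_set_nonneg show ?thesis by (rule order_trans)
qed

lemma gamma2_set_nonempty:
  "{row_norm U * col_norm V | U V k.
     U \<in> carrier_mat (dim_row M) k \<and> V \<in> carrier_mat k (dim_col M) \<and> U * V = M} \<noteq> {}"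
proof -
  have "M \<in> carrier_mat (dim_row M) (dim_col M)"
    and "1\<^sub>m (dim_col M) \<in> carrier_mat (dim_col M) (dim_col M)" by simp_all
  moreover from this(1) have "M * 1\<^sub>m (dim_col M) = M" by (rule right_mult_one_mat)
  ultimately have "row_norm M * col_norm (1\<^sub>m (dim_col M)) \<in> {row_norm U * col_norm V | U V k.
     U \<in> carrier_mat (dim_row M) k \<and> V \<in> carrier_mat k (dim_col M) \<and> U * V = M}"
    by (intro CollectI exI conjI) (rule refl)
  then show ?thesis by (metis empty_iff)
qed

lemma gamma2_set_bdd_below:
  assumes "0 < dim_row M" "0 < dim_col M"
  shows "bdd_below {row_norm U * col_norm V | U V k.
     U \<in> carrier_mat (dim_row M) k \<and> V \<in> carrier_mat k (dim_col M) \<and> U * V = M}"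
proof (rule bdd_belowI[of _ 0])
  fix x
  assume "x \<in> {row_norm U * col_norm V | U V k.
     U \<in> carrier_mat (dim_row M) k \<and> V \<in> carrier_mat k (dim_col M) \<and> U * V = M}"
  then obtain U V k where x: "x = row_norm U * col_norm V"
    and "U \<in> carrier_mat (dim_row M) k" "V \<in> carrier_mat k (dim_col M)"
    by (elim CollectE exE conjE)
  then have "0 \<le> row_norm U" "0 \<le> col_norm V"
    using assms by (simp_all add: row_norm_nonneg col_norm_nonneg carrier_matD)
  then show "0 \<le> x" unfolding x by (rule mult_nonneg_nonneg)
qed

end

(*
  Write M_ij = <u_i, v_j> with bounded vectors. For a matrix N proportional to a row scaling of M,
  the matrix 2(1 + N N^T)^(-1) N is a contraction, so pairing it with another row scaling of M is
  controlled by the norms of the factors; expanding the resolvent to second order turns this into a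
  lower bound on sum_{i,l} codeg(i,l)^2 / deg(l), with no upper bound on the row degrees required.
  If all column degrees lie in [L, 2L] and low-degree rows are rare, some row l of large degree then
  has, on average over its neighbours, a positive density of edges between the two neighbourhoods,
  which forces an all-ones t x t block.

  To reach this situation, delete low-degree vertices until all degrees are large. On the larger
  side, the vertices of degree about 2^l cannot for every l span only O(|A|) edges, where A is the
  smaller side: otherwise their numbers would sum geometrically to less than |A|.
*)
theory Submission
  imports Defs "Jordan_Normal_Form.Determinant"
begin

section \<open>Linear algebra: the resolvent of a Gram matrix and a trace inequality\<close>

lemma scalar_prod_self_nonneg: "0 \<le> v \<bullet> (v :: real vec)"
  by (simp add: scalar_prod_def sum_nonneg)

text \<open>A kernel vector v of 1 + G satisfies 0 = v.(1 + G)v = |v|^2 + |N^T v|^2, hence v = 0.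
  The inverse is returned in the form \<open>Z + G * Z = 1\<^sub>m m\<close> because with z = Z x it
  reads x = z + G z, the hypothesis of \<open>resolvent_bounds\<close>.\<close>

lemma one_plus_gram_inverse:
  fixes N :: "real mat"
  assumes N: "N \<in> carrier_mat m n" and G: "G = N * transpose_mat N"
  obtains Z where "Z \<in> carrier_mat m m" "Z + G * Z = 1\<^sub>m m"
proof -
  have Gc: "G \<in> carrier_mat m m" using N G by simp
  have "det (1\<^sub>m m + G) \<noteq> 0"
  proof
    assume "det (1\<^sub>m m + G) = 0"
    then obtain v where v: "v \<in> carrier_vec m" "v \<noteq> 0\<^sub>v m" "(1\<^sub>m m + G) *\<^sub>v v = 0\<^sub>v m"
      using det_0_iff_vec_prod_zero[of "1\<^sub>m m + G" m] Gc by auto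
    let ?w = "transpose_mat N *\<^sub>v v"
    have w: "?w \<in> carrier_vec n" using N v by simp
    have "(1\<^sub>m m + G) *\<^sub>v v = v + N *\<^sub>v ?w"
      using N v(1) unfolding G
      by (subst add_mult_distrib_mat_vec[where nr=m and nc=m]) (auto simp: assoc_mult_mat_vec[where n\<^sub>2=n])
    then have "v \<bullet> (v + N *\<^sub>v ?w) = v \<bullet> 0\<^sub>v m" using v(3) by simp
    moreover have "v \<bullet> (v + N *\<^sub>v ?w) = v \<bullet> v + v \<bullet> (N *\<^sub>v ?w)"
      using N v(1) w by (intro scalar_prod_add_distrib[where n=m]) auto
    moreover have "v \<bullet> (N *\<^sub>v ?w) = ?w \<bullet> ?w"
      using transpose_vec_mult_scalar[OF N w v(1)] by simp
    ultimately have "v \<bullet> v = 0"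
      using scalar_prod_self_nonneg[of ?w] scalar_prod_self_nonneg[of v] v(1) by simp
    then show False using v conjugate_square_eq_0_vec[of v m] by simp
  qed
  then obtain Z where Z: "Z \<in> carrier_mat m m" "(1\<^sub>m m + G) * Z = 1\<^sub>m m"
    using det_non_zero_imp_unit[of "1\<^sub>m m + G" m] Gc
    unfolding Units_def ring_mat_def by auto
  then have "Z + G * Z = 1\<^sub>m m"
    using Gc by (simp add: add_mult_distrib_mat[of _ m m])
  with Z(1) that show ?thesis by blast
qed

lemma scalar_prod_gram:
  fixes N :: "real mat"
  assumes N: "N \<in> carrier_mat m n" and G: "G = N * transpose_mat N"
    and x: "x \<in> carrier_vec m" and y: "y \<in> carrier_vec m"
  shows "x \<bullet> (G *\<^sub>v y) = (transpose_mat N *\<^sub>v x) \<bullet> (transpose_mat N *\<^sub>v y)"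
proof -
  have "G *\<^sub>v y = N *\<^sub>v (transpose_mat N *\<^sub>v y)"
    using N y unfolding G by (simp add: assoc_mult_mat_vec[where n\<^sub>2=n])
  then show ?thesis
    using transpose_vec_mult_scalar[OF N _ x, of "transpose_mat N *\<^sub>v y"] N y by simp
qed

text \<open>With \<open>z = (1 + G)\<inverse> x\<close>: part one is the truncation \<open>G(1 + G)\<inverse> \<ge> G - G\<^sup>2\<close>, part two says that
  \<open>2 N\<^sup>T (1 + G)\<inverse>\<close> is a contraction, because \<open>2\<sigma> \<le> 1 + \<sigma>\<^sup>2\<close> for every singular value \<open>\<sigma>\<close> of \<open>N\<close>.\<close>

lemma resolvent_bounds:
  fixes N :: "real mat"
  assumes N: "N \<in> carrier_mat m n" and G: "G = N * transpose_mat N"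
    and z: "z \<in> carrier_vec m" and x: "x = z + G *\<^sub>v z"
  shows "x \<bullet> (G *\<^sub>v x) - (G *\<^sub>v x) \<bullet> (G *\<^sub>v x) \<le> x \<bullet> (G *\<^sub>v z)"
    and "4 * ((transpose_mat N *\<^sub>v z) \<bullet> (transpose_mat N *\<^sub>v z)) \<le> x \<bullet> x"
proof -
  have Gc: "G \<in> carrier_mat m m" using N G by simp
  \<comment> \<open>With g = G z and h = G^2 z, every scalar product below is a combination of z.z,
    z.g, g.g, g.h and h.h. The two sides of the first claim differ by g.h + h.h, and g.h = |N^T
    g|^2.\<close>
  define g h where "g = G *\<^sub>v z" and "h = G *\<^sub>v g"
  have g: "g \<in> carrier_vec m" and h: "h \<in> carrier_vec m"
    unfolding g_def h_def using Gc z by auto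
  note gp = scalar_prod_gram[OF N G]
  have comm: "a \<bullet> b = b \<bullet> a" if "a \<in> carrier_vec m" "b \<in> carrier_vec m" for a b :: "real vec"
    using that by (rule comm_scalar_prod)
  have zh: "z \<bullet> h = g \<bullet> g"
    using gp[OF z g] gp[OF g z] Gc z g comm comm_scalar_prod[of "transpose_mat N *\<^sub>v z" n "transpose_mat N *\<^sub>v g"] N
    unfolding h_def[symmetric] g_def[symmetric] by auto
  have Gx: "G *\<^sub>v x = g + h"
    unfolding x using Gc z g by (simp add: mult_add_distrib_mat_vec[of G m m] g_def h_def)
  have xg: "x = z + g" using x g_def by simp
  have gh: "0 \<le> g \<bullet> h" unfolding h_def using gp[OF g g] scalar_prod_self_nonneg by simp
  have hh: "0 \<le> h \<bullet> h" by (rule scalar_prod_self_nonneg)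
  note d = scalar_prod_add_distrib[of _ m] add_scalar_prod_distrib[of _ m]
  have 1: "x \<bullet> (G *\<^sub>v x) = z \<bullet> g + 2 * (g \<bullet> g) + g \<bullet> h"
    by (subst Gx, subst xg) (use z g h zh in \<open>simp add: d\<close>)
  have 2: "(G *\<^sub>v x) \<bullet> (G *\<^sub>v x) = g \<bullet> g + 2 * (g \<bullet> h) + h \<bullet> h"
    unfolding Gx using g h comm[OF h g] by (simp add: d)
  have 3: "x \<bullet> (G *\<^sub>v z) = z \<bullet> g + g \<bullet> g"
    unfolding g_def[symmetric] by (subst xg) (use z g in \<open>simp add: d\<close>)
  show "x \<bullet> (G *\<^sub>v x) - (G *\<^sub>v x) \<bullet> (G *\<^sub>v x) \<le> x \<bullet> (G *\<^sub>v z)"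
    unfolding 1 2 3 using gh hh by simp
  \<comment> \<open>Expanding |z - g|^2 gives 4 z.g \<le> |z + g|^2 = x.x, and z.g = |N^T
    z|^2.\<close>
  have "0 \<le> (z - g) \<bullet> (z - g)" by (rule scalar_prod_self_nonneg)
  also have "\<dots> = z \<bullet> z - 2 * (z \<bullet> g) + g \<bullet> g"
    using z g comm[OF g z] by (simp add: minus_scalar_prod_distrib[of _ m] scalar_prod_minus_distrib[of _ m])
  finally have "4 * (z \<bullet> g) \<le> x \<bullet> x"
    by (subst xg, subst xg) (use z g comm[OF g z] in \<open>simp add: d\<close>)
  then show "4 * ((transpose_mat N *\<^sub>v z) \<bullet> (transpose_mat N *\<^sub>v z)) \<le> x \<bullet> x"
    using gp[OF z z] by (simp add: g_def)
qed

text \<open>The trace of P W Y with Y = N^T (1 + G)^(-1) is estimated in two ways. Since P W =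
  diag(r) N, it is the sum of r_i times the diagonal entries of G (1 + G)^(-1), which are at least
  those of G - G^2. It is also the trace of W (Y P), where Cauchy-Schwarz and the contraction 2Y
  give half the product of the Frobenius norms of P and W.\<close>

lemma trace_inequality:
  fixes N P W :: "real mat"
  assumes N: "N \<in> carrier_mat m n" and P: "P \<in> carrier_mat m k" and W: "W \<in> carrier_mat k n"
    and PW: "\<And>i j. i < m \<Longrightarrow> j < n \<Longrightarrow> (P * W) $$ (i, j) = r i * N $$ (i, j)"
    and r: "\<And>i. i < m \<Longrightarrow> 0 \<le> r i"
    and G: "G = N * transpose_mat N"
  shows "2 * (\<Sum>i<m. r i * (G $$ (i, i) - (\<Sum>l<m. (G $$ (i, l))\<^sup>2)))
    \<le> sqrt (\<Sum>i<m. \<Sum>c<k. (P $$ (i, c))\<^sup>2) * sqrt (\<Sum>c<k. \<Sum>j<n. (W $$ (c, j))\<^sup>2)"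
proof -
  have Gc: "G \<in> carrier_mat m m" using N G by simp
  obtain Z where Z: "Z \<in> carrier_mat m m" "Z + G * Z = 1\<^sub>m m"
    using one_plus_gram_inverse[OF N G] .
  define Y where "Y = transpose_mat N * Z"
  define Q where "Q = Y * P"
  have Y: "Y \<in> carrier_mat n m" unfolding Y_def using N Z by simp
  have Q: "Q \<in> carrier_mat n k" unfolding Q_def using Y P by simp
  have ZGZ: "x = Z *\<^sub>v x + G *\<^sub>v (Z *\<^sub>v x)" if x: "x \<in> carrier_vec m" for x
  proof -
    have "x = (Z + G * Z) *\<^sub>v x" using Z x by simp
    also have "\<dots> = Z *\<^sub>v x + (G * Z) *\<^sub>v x"
      using Z Gc x by (intro add_mult_distrib_mat_vec[of _ m m]) auto
    also have "(G * Z) *\<^sub>v x = G *\<^sub>v (Z *\<^sub>v x)"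
      using Z Gc x by (intro assoc_mult_mat_vec[of _ m m]) auto
    finally show ?thesis .
  qed
  have sym: "G $$ (l, i) = G $$ (i, l)" if "i < m" "l < m" for i l
    unfolding G using N that comm_scalar_prod[of "row N l" n "row N i"] by simp
  \<comment> \<open>The first bound of \<open>resolvent_bounds\<close> at the i-th unit vector; its
    right-hand side is the (i, i) entry of N Y.\<close>
  have diag: "G $$ (i, i) - (\<Sum>l<m. (G $$ (i, l))\<^sup>2) \<le> (\<Sum>j<n. N $$ (i, j) * Y $$ (j, i))"
    if i: "i < m" for i
  proof -
    let ?x = "unit_vec m i"
    let ?z = "Z *\<^sub>v ?x"
    have z: "?z \<in> carrier_vec m" using Z by simp
    have Gx: "G *\<^sub>v ?x = col G i"
      using Gc i by (auto simp: mult_mat_vec_def)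
    have 1: "?x \<bullet> (G *\<^sub>v ?x) = G $$ (i, i)" using Gx Gc i by simp
    have "(G *\<^sub>v ?x) \<bullet> (G *\<^sub>v ?x) = (\<Sum>l<m. (G $$ (l, i))\<^sup>2)"
      unfolding Gx using Gc i by (simp add: scalar_prod_def power2_eq_square atLeast0LessThan)
    also have "\<dots> = (\<Sum>l<m. (G $$ (i, l))\<^sup>2)" using sym i by simp
    finally have 2: "(G *\<^sub>v ?x) \<bullet> (G *\<^sub>v ?x) = (\<Sum>l<m. (G $$ (i, l))\<^sup>2)" .
    have "?x \<bullet> (G *\<^sub>v ?z) = (transpose_mat N *\<^sub>v ?x) \<bullet> (transpose_mat N *\<^sub>v ?z)"
      using scalar_prod_gram[OF N G _ z] by simp
    also have "transpose_mat N *\<^sub>v ?x = row N i" using N i by (auto simp: mult_mat_vec_def)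
    also have "transpose_mat N *\<^sub>v ?z = Y *\<^sub>v ?x"
      unfolding Y_def using N Z by (simp add: assoc_mult_mat_vec[of _ n m])
    also have "Y *\<^sub>v ?x = col Y i" using Y i by (auto simp: mult_mat_vec_def)
    also have "row N i \<bullet> col Y i = (\<Sum>j<n. N $$ (i, j) * Y $$ (j, i))"
      using N Y i by (simp add: scalar_prod_def atLeast0LessThan)
    finally show ?thesis
      using resolvent_bounds(1)[OF N G z ZGZ] 1 2 by simp
  qed
  have PWij: "(\<Sum>c<k. P $$ (i, c) * W $$ (c, j)) = r i * N $$ (i, j)" if "i < m" "j < n" for i j
    using PW[OF that] P W that by (simp add: scalar_prod_def atLeast0LessThan)
  have Qjc: "Q $$ (j, c) = (\<Sum>i<m. Y $$ (j, i) * P $$ (i, c))" if "j < n" "c < k" for j c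
    unfolding Q_def using Y P that by (simp add: scalar_prod_def atLeast0LessThan)
  have "(\<Sum>i<m. r i * (G $$ (i, i) - (\<Sum>l<m. (G $$ (i, l))\<^sup>2)))
      \<le> (\<Sum>i<m. r i * (\<Sum>j<n. N $$ (i, j) * Y $$ (j, i)))"
    by (intro sum_mono mult_left_mono diag r) auto
  \<comment> \<open>Here r_i N_ij is replaced by the entry of P W. The interchanges that follow are
    the cyclic shift from the trace of P W Y to the trace of W Q.\<close>
  also have "\<dots> = (\<Sum>i<m. \<Sum>j<n. \<Sum>c<k. W $$ (c, j) * (Y $$ (j, i) * P $$ (i, c)))"
  proof (intro sum.cong refl)
    fix i assume i: "i \<in> {..<m}"
    have "r i * (\<Sum>j<n. N $$ (i, j) * Y $$ (j, i)) = (\<Sum>j<n. (r i * N $$ (i, j)) * Y $$ (j, i))"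
      by (simp add: sum_distrib_left mult.assoc)
    also have "\<dots> = (\<Sum>j<n. \<Sum>c<k. W $$ (c, j) * (Y $$ (j, i) * P $$ (i, c)))"
      using i by (intro sum.cong refl, subst PWij[symmetric]) (auto simp: sum_distrib_left sum_distrib_right mult_ac)
    finally show "r i * (\<Sum>j<n. N $$ (i, j) * Y $$ (j, i)) =
      (\<Sum>j<n. \<Sum>c<k. W $$ (c, j) * (Y $$ (j, i) * P $$ (i, c)))" .
  qed
  also have "\<dots> = (\<Sum>j<n. \<Sum>i<m. \<Sum>c<k. W $$ (c, j) * (Y $$ (j, i) * P $$ (i, c)))"
    by (rule sum.swap)
  also have "\<dots> = (\<Sum>j<n. \<Sum>c<k. \<Sum>i<m. W $$ (c, j) * (Y $$ (j, i) * P $$ (i, c)))"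
    by (intro sum.cong refl sum.swap)
  also have "\<dots> = (\<Sum>c<k. \<Sum>j<n. \<Sum>i<m. W $$ (c, j) * (Y $$ (j, i) * P $$ (i, c)))"
    by (rule sum.swap)
  also have "\<dots> = (\<Sum>c<k. \<Sum>j<n. W $$ (c, j) * Q $$ (j, c))"
    by (intro sum.cong refl) (simp add: Qjc sum_distrib_left)
  also have "\<dots> = (\<Sum>(c, j)\<in>{..<k} \<times> {..<n}. W $$ (c, j) * Q $$ (j, c))"
    by (simp add: sum.cartesian_product)
  also have "\<dots> \<le> (\<Sum>p\<in>{..<k} \<times> {..<n}. \<bar>W $$ p\<bar> * \<bar>Q $$ (prod.swap p)\<bar>)"
    by (intro sum_mono) (auto simp: abs_mult[symmetric])
  also have "\<dots> \<le> L2_set (($$) W) ({..<k} \<times> {..<n}) * L2_set (\<lambda>p. Q $$ (prod.swap p)) ({..<k} \<times> {..<n})"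
    by (rule L2_set_mult_ineq)
  finally have main: "(\<Sum>i<m. r i * (G $$ (i, i) - (\<Sum>l<m. (G $$ (i, l))\<^sup>2)))
      \<le> sqrt (\<Sum>c<k. \<Sum>j<n. (W $$ (c, j))\<^sup>2) * sqrt (\<Sum>c<k. \<Sum>j<n. (Q $$ (j, c))\<^sup>2)"
    by (simp add: L2_set_def sum.cartesian_product case_prod_beta prod.swap_def)
  \<comment> \<open>Each column of Q is Y applied to a column of P, so the contraction bound holds
    column by column and sums to Frobenius norms.\<close>
  have "4 * (\<Sum>j<n. (Q $$ (j, c))\<^sup>2) \<le> (\<Sum>i<m. (P $$ (i, c))\<^sup>2)" if c: "c < k" for c
  proof -
    have x: "col P c \<in> carrier_vec m" using P c by auto
    then have z: "Z *\<^sub>v col P c \<in> carrier_vec m" using Z by simp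
    have "transpose_mat N *\<^sub>v (Z *\<^sub>v col P c) = Y *\<^sub>v col P c"
      unfolding Y_def using N Z x by (simp add: assoc_mult_mat_vec[of _ n m])
    also have "\<dots> = col Q c" unfolding Q_def using Y P c by auto
    finally show ?thesis
      using resolvent_bounds(2)[OF N G z ZGZ[OF x]] Q P c
      by (simp add: scalar_prod_def power2_eq_square atLeast0LessThan)
  qed
  then have "(\<Sum>c<k. 4 * (\<Sum>j<n. (Q $$ (j, c))\<^sup>2)) \<le> (\<Sum>c<k. \<Sum>i<m. (P $$ (i, c))\<^sup>2)"
    by (intro sum_mono) auto
  also have "\<dots> = (\<Sum>i<m. \<Sum>c<k. (P $$ (i, c))\<^sup>2)" by (rule sum.swap)
  finally have "sqrt (4 * (\<Sum>c<k. \<Sum>j<n. (Q $$ (j, c))\<^sup>2)) \<le> sqrt (\<Sum>i<m. \<Sum>c<k. (P $$ (i, c))\<^sup>2)"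
    by (simp add: sum_distrib_left)
  then have "2 * sqrt (\<Sum>c<k. \<Sum>j<n. (Q $$ (j, c))\<^sup>2) \<le> sqrt (\<Sum>i<m. \<Sum>c<k. (P $$ (i, c))\<^sup>2)"
    by (simp add: real_sqrt_mult)
  from mult_left_mono[OF this, of "sqrt (\<Sum>c<k. \<Sum>j<n. (W $$ (c, j))\<^sup>2)"] main
  show ?thesis by (simp add: sum_nonneg mult_ac)
qed

section \<open>Bounded factorizations force large codegree energy\<close>

text \<open>A witness for a \<gamma>_2 bound on the submatrix with rows A and columns B. The numbers
  a and b are upper bounds for the norms, not maxima, so the property passes to subsets, empty ones
  included; index sets avoid renumbering after deletions.\<close>

definition factors_within :: "real \<Rightarrow> nat set \<Rightarrow> nat set \<Rightarrow> (nat \<Rightarrow> nat \<Rightarrow> real) \<Rightarrow> bool" where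
  "factors_within \<Gamma> A B f \<longleftrightarrow> (\<exists>a b k u v. 0 \<le> a \<and> 0 \<le> b \<and> a * b \<le> \<Gamma> \<and>
     (\<forall>i\<in>A. (\<Sum>c<k::nat. (u i c)\<^sup>2) \<le> a\<^sup>2) \<and> (\<forall>j\<in>B. (\<Sum>c<k. (v c j)\<^sup>2) \<le> b\<^sup>2) \<and>
     (\<forall>i\<in>A. \<forall>j\<in>B. f i j = (\<Sum>c<k. u i c * v c j)))"

lemma factors_within_subset:
  assumes "factors_within \<Gamma> A B f" "A' \<subseteq> A" "B' \<subseteq> B"
  shows "factors_within \<Gamma> A' B' f"
proof -
  obtain a b k u v where 1: "0 \<le> a" "0 \<le> b" "a * b \<le> \<Gamma>"
     "\<forall>i\<in>A. (\<Sum>c<k::nat. (u i c)\<^sup>2) \<le> a\<^sup>2" "\<forall>j\<in>B. (\<Sum>c<k. (v c j)\<^sup>2) \<le> b\<^sup>2"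
     "\<forall>i\<in>A. \<forall>j\<in>B. f i j = (\<Sum>c<k. u i c * v c j)"
    using assms(1) unfolding factors_within_def by blast
  show ?thesis
    unfolding factors_within_def
    by (rule exI[of _ a], rule exI[of _ b], rule exI[of _ k], rule exI[of _ u],
        rule exI[of _ v])
       (use 1 assms(2,3) in blast)
qed

lemma factors_within_transpose:
  assumes "factors_within \<Gamma> A B f"
  shows "factors_within \<Gamma> B A (\<lambda>j i. f i j)"
proof -
  obtain a b k u v where 1: "0 \<le> a" "0 \<le> b" "a * b \<le> \<Gamma>"
     "\<forall>i\<in>A. (\<Sum>c<k::nat. (u i c)\<^sup>2) \<le> a\<^sup>2" "\<forall>j\<in>B. (\<Sum>c<k. (v c j)\<^sup>2) \<le> b\<^sup>2"
     "\<forall>i\<in>A. \<forall>j\<in>B. f i j = (\<Sum>c<k. u i c * v c j)"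
    using assms unfolding factors_within_def by blast
  show ?thesis
    unfolding factors_within_def
    by (rule exI[of _ b], rule exI[of _ a], rule exI[of _ k], rule exI[of _ "\<lambda>j c. v c j"],
        rule exI[of _ "\<lambda>c i. u i c"]) (use 1 in \<open>simp add: mult.commute\<close>)
qed

text \<open>Data on index sets become matrices by padding with zeros; sums over the padded range
  collapse back in this way.\<close>

lemma sum_restrict_lessThan:
  fixes g :: "nat \<Rightarrow> 'a :: comm_monoid_add"
  assumes "A \<subseteq> {..<m}"
  shows "(\<Sum>i<m. if i \<in> A then g i else 0) = sum g A"
proof -
  have "{..<m} \<inter> A = A" using assms by auto
  then show ?thesis by (simp flip: sum.inter_restrict)
qed

text \<open>\<open>trace_inequality\<close> with N_ij = sqrt(\<tau>/D_i) f_ij, where row i of P is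
  sqrt(D_i) u_i and W consists of the v_j. The row scaling makes G_il = \<tau> codeg(i,l) / sqrt(D_i
  D_l), with diagonal \<tau> on nonempty rows because codeg(i,i) = D_i for 0/1 entries. With e the
  sum of the D_i, the squared Frobenius norms of P and W are at most a^2 e and b^2 |B|.\<close>

lemma factorization_energy:
  fixes f :: "nat \<Rightarrow> nat \<Rightarrow> real" and B :: "nat set"
  defines "D \<equiv> \<lambda>i. \<Sum>j\<in>B. f i j" and "codeg \<equiv> \<lambda>i l. \<Sum>j\<in>B. f i j * f l j"
  assumes fin: "finite A" "finite B"
    and f01: "\<And>i j. i \<in> A \<Longrightarrow> j \<in> B \<Longrightarrow> f i j \<in> {0, 1}"
    and fac: "factors_within \<Gamma> A B f" and lam: "0 < \<tau>"
  shows "2 * sqrt \<tau> * ((\<Sum>i\<in>A. D i) - \<tau> * (\<Sum>i\<in>A. \<Sum>l\<in>A. (codeg i l)\<^sup>2 / D l))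
    \<le> \<Gamma> * sqrt ((\<Sum>i\<in>A. D i) * card B)"
proof -
  obtain a b k u v where ab: "0 \<le> a" "0 \<le> b" "a * b \<le> \<Gamma>"
    and u: "\<And>i. i \<in> A \<Longrightarrow> (\<Sum>c<k::nat. (u i c)\<^sup>2) \<le> a\<^sup>2"
    and v: "\<And>j. j \<in> B \<Longrightarrow> (\<Sum>c<k. (v c j)\<^sup>2) \<le> b\<^sup>2"
    and uv: "\<And>i j. i \<in> A \<Longrightarrow> j \<in> B \<Longrightarrow> f i j = (\<Sum>c<k. u i c * v c j)"
    using fac unfolding factors_within_def by blast
  obtain m n where m: "A \<subseteq> {..<m}" and n: "B \<subseteq> {..<n}"
    using fin finite_nat_bounded by meson
  have D0: "0 \<le> D i" if "i \<in> A" for i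
    unfolding D_def using f01[OF that] by (intro sum_nonneg) force
  have cod_self: "codeg i i = D i" if "i \<in> A" for i
    unfolding D_def codeg_def using f01[OF that] by (intro sum.cong refl) force
  have cod0: "codeg i l = 0" if "i \<in> A" "l \<in> A" "D i = 0" for i l
  proof -
    have "f i j = 0" if "j \<in> B" for j
      using that \<open>D i = 0\<close> f01[OF \<open>i \<in> A\<close>] fin unfolding D_def
      by (subst (asm) sum_nonneg_eq_0_iff) force+
    then show ?thesis by (simp add: codeg_def)
  qed
  \<comment> \<open>Empty rows need no separate treatment: there \<open>\<tau> / D i = \<tau> / 0 = 0\<close>.\<close>
  define N where "N = mat m n (\<lambda>(i, j). if i \<in> A \<and> j \<in> B then sqrt (\<tau> / D i) * f i j else 0)"
  define P where "P = mat m k (\<lambda>(i, c). if i \<in> A then sqrt (D i) * u i c else 0)"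
  define W where "W = mat k n (\<lambda>(c, j). if j \<in> B then v c j else 0)"
  define r where "r i = (if i \<in> A then D i / sqrt \<tau> else 0)" for i
  define G where "G = N * transpose_mat N"
  have Nc: "N \<in> carrier_mat m n" and Pc: "P \<in> carrier_mat m k" and Wc: "W \<in> carrier_mat k n"
    unfolding N_def P_def W_def by auto
  have Gil: "G $$ (i, l) = (if i \<in> A \<and> l \<in> A then sqrt (\<tau> / D i) * sqrt (\<tau> / D l) * codeg i l else 0)"
    if "i < m" "l < m" for i l
  proof -
    have "G $$ (i, l) = (\<Sum>j<n. if j \<in> B then
        (if i \<in> A \<and> l \<in> A then sqrt (\<tau> / D i) * sqrt (\<tau> / D l) * (f i j * f l j) else 0) else 0)"
      unfolding G_def using that Nc
      by (auto simp: scalar_prod_def atLeast0LessThan N_def intro!: sum.cong)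
    then show ?thesis
      by (cases "i \<in> A \<and> l \<in> A") (auto simp: sum_restrict_lessThan[OF n] codeg_def sum_distrib_left)
  qed
  have PW: "(P * W) $$ (i, j) = r i * N $$ (i, j)" if ij: "i < m" "j < n" for i j
  proof -
    have "(P * W) $$ (i, j) = (if i \<in> A \<and> j \<in> B then sqrt (D i) * (\<Sum>c<k. u i c * v c j) else 0)"
      using ij by (auto simp: P_def W_def scalar_prod_def atLeast0LessThan sum_distrib_left mult.assoc)
    moreover have "D i / sqrt \<tau> * (sqrt (\<tau> / D i) * x) = sqrt (D i) * x" if "i \<in> A" for x
    proof -
      have "D i / sqrt \<tau> * sqrt (\<tau> / D i) = sqrt (D i)"
        using D0[OF that] lam by (cases "D i = 0") (simp_all add: real_sqrt_divide real_div_sqrt)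
      then show ?thesis by (simp only: mult.assoc[symmetric])
    qed
    ultimately show ?thesis
      using ij by (auto simp: N_def r_def uv simp del: times_divide_eq_left)
  qed
  have r0: "0 \<le> r i" for i unfolding r_def using D0 lam by simp
  \<comment> \<open>The weight r_i = D_i / sqrt(\<tau>) cancels the factor 1/D_i that every G_il^2
    carries; only the division by D_l survives.\<close>
  have inner: "r i * (G $$ (i, i) - (\<Sum>l<m. (G $$ (i, l))\<^sup>2)) =
      (if i \<in> A then sqrt \<tau> * (D i - \<tau> * (\<Sum>l\<in>A. (codeg i l)\<^sup>2 / D l)) else 0)"
    if i: "i < m" for i
  proof (cases "i \<in> A")
    case True
    show ?thesis
    proof (cases "D i = 0")
      case True
      then show ?thesis using \<open>i \<in> A\<close> cod0 by (simp add: r_def)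
    next
      case False
      then have Di: "D i > 0" using D0[OF \<open>i \<in> A\<close>] by simp
      have g1: "G $$ (i, i) = \<tau>"
        using Gil[OF i i] \<open>i \<in> A\<close> Di lam cod_self by simp
      have "(\<Sum>l<m. (G $$ (i, l))\<^sup>2) = (\<Sum>l<m. if l \<in> A then \<tau> / D i * (\<tau> * ((codeg i l)\<^sup>2 / D l)) else 0)"
        using i \<open>i \<in> A\<close> Di D0 lam by (intro sum.cong refl) (simp add: Gil power_mult_distrib)
      also have "\<dots> = \<tau> / D i * (\<tau> * (\<Sum>l\<in>A. (codeg i l)\<^sup>2 / D l))"
        by (simp add: sum_restrict_lessThan[OF m] sum_distrib_left)
      finally have "r i * (G $$ (i, i) - (\<Sum>l<m. (G $$ (i, l))\<^sup>2)) =
          D i / sqrt \<tau> * (\<tau> - \<tau> / D i * (\<tau> * (\<Sum>l\<in>A. (codeg i l)\<^sup>2 / D l)))"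
        using \<open>i \<in> A\<close> g1 by (simp add: r_def)
      also have "\<dots> = \<tau> / sqrt \<tau> * (D i - \<tau> * (\<Sum>l\<in>A. (codeg i l)\<^sup>2 / D l))"
        using Di lam by (simp add: field_simps)
      also have "\<tau> / sqrt \<tau> = sqrt \<tau>" using lam by (simp add: real_div_sqrt)
      finally show ?thesis using \<open>i \<in> A\<close> by simp
    qed
  qed (simp add: r_def)
  have "(\<Sum>i<m. r i * (G $$ (i, i) - (\<Sum>l<m. (G $$ (i, l))\<^sup>2))) =
      (\<Sum>i\<in>A. sqrt \<tau> * (D i - \<tau> * (\<Sum>l\<in>A. (codeg i l)\<^sup>2 / D l)))"
    by (simp add: inner sum_restrict_lessThan[OF m])
  also have "\<dots> = sqrt \<tau> * ((\<Sum>i\<in>A. D i) - \<tau> * (\<Sum>i\<in>A. \<Sum>l\<in>A. (codeg i l)\<^sup>2 / D l))"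
    by (simp add: sum_subtractf sum_distrib_left right_diff_distrib)
  finally have lhs: "(\<Sum>i<m. r i * (G $$ (i, i) - (\<Sum>l<m. (G $$ (i, l))\<^sup>2))) = \<dots>" .
  have "(\<Sum>i<m. \<Sum>c<k. (P $$ (i, c))\<^sup>2) = (\<Sum>i<m. if i \<in> A then D i * (\<Sum>c<k. (u i c)\<^sup>2) else 0)"
    using D0 by (intro sum.cong refl) (simp add: P_def power_mult_distrib sum_distrib_left)
  also have "\<dots> \<le> (\<Sum>i\<in>A. D i * a\<^sup>2)"
    by (simp add: sum_restrict_lessThan[OF m]) (intro sum_mono mult_left_mono u D0)
  finally have "sqrt (\<Sum>i<m. \<Sum>c<k. (P $$ (i, c))\<^sup>2) \<le> sqrt ((\<Sum>i\<in>A. D i) * a\<^sup>2)"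
    by (simp add: sum_distrib_right)
  then have P2: "sqrt (\<Sum>i<m. \<Sum>c<k. (P $$ (i, c))\<^sup>2) \<le> a * sqrt (\<Sum>i\<in>A. D i)"
    using ab by (simp add: real_sqrt_mult mult.commute)
  have "(\<Sum>c<k. \<Sum>j<n. (W $$ (c, j))\<^sup>2) = (\<Sum>j<n. \<Sum>c<k. (W $$ (c, j))\<^sup>2)" by (rule sum.swap)
  also have "\<dots> = (\<Sum>j<n. if j \<in> B then \<Sum>c<k. (v c j)\<^sup>2 else 0)"
    by (intro sum.cong refl) (simp add: W_def)
  also have "\<dots> \<le> (\<Sum>j\<in>B. b\<^sup>2)"
    by (simp add: sum_restrict_lessThan[OF n] del: sum_constant) (intro sum_mono v)
  finally have "sqrt (\<Sum>c<k. \<Sum>j<n. (W $$ (c, j))\<^sup>2) \<le> sqrt (card B * b\<^sup>2)"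
    by simp
  then have W2: "sqrt (\<Sum>c<k. \<Sum>j<n. (W $$ (c, j))\<^sup>2) \<le> b * sqrt (card B)"
    using ab by (simp add: real_sqrt_mult mult.commute)
  have "2 * (sqrt \<tau> * ((\<Sum>i\<in>A. D i) - \<tau> * (\<Sum>i\<in>A. \<Sum>l\<in>A. (codeg i l)\<^sup>2 / D l)))
      \<le> sqrt (\<Sum>i<m. \<Sum>c<k. (P $$ (i, c))\<^sup>2) * sqrt (\<Sum>c<k. \<Sum>j<n. (W $$ (c, j))\<^sup>2)"
    using trace_inequality[OF Nc Pc Wc PW r0 G_def] unfolding lhs .
  also have "\<dots> \<le> (a * sqrt (\<Sum>i\<in>A. D i)) * (b * sqrt (card B))"
    using ab D0 by (intro mult_mono P2 W2) (auto intro!: mult_nonneg_nonneg sum_nonneg)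
  also have "\<dots> = (a * b) * sqrt ((\<Sum>i\<in>A. D i) * card B)"
    by (simp add: real_sqrt_mult mult_ac)
  also have "\<dots> \<le> \<Gamma> * sqrt ((\<Sum>i\<in>A. D i) * card B)"
    using ab D0 by (intro mult_right_mono) (auto intro!: sum_nonneg mult_nonneg_nonneg)
  finally show ?thesis by simp
qed

text \<open>If the energy were smaller, the choice of \<tau> would make the subtracted term in
  \<open>factorization_energy\<close> less than e/2. What remains gives \<tau> e < \<Gamma>^2 |B|,
  that is 2e < L |B|, whereas counting ones by columns gives e \<ge> L |B|.\<close>

lemma codegree_energy_ge:
  fixes f :: "nat \<Rightarrow> nat \<Rightarrow> real" and B :: "nat set"
  defines "D \<equiv> \<lambda>i. \<Sum>j\<in>B. f i j" and "codeg \<equiv> \<lambda>i l. \<Sum>j\<in>B. f i j * f l j"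
  assumes fin: "finite A" "finite B" and B: "B \<noteq> {}"
    and f01: "\<And>i j. i \<in> A \<Longrightarrow> j \<in> B \<Longrightarrow> f i j \<in> {0, 1}"
    and fac: "factors_within \<Gamma> A B f" and \<Gamma>: "0 < \<Gamma>" and L: "0 < L"
    and deg: "\<And>j. j \<in> B \<Longrightarrow> L \<le> (\<Sum>i\<in>A. f i j)"
  shows "L * (\<Sum>i\<in>A. D i) \<le> 4 * \<Gamma>\<^sup>2 * (\<Sum>i\<in>A. \<Sum>l\<in>A. (codeg i l)\<^sup>2 / D l)"
proof (rule ccontr)
  define e where "e = (\<Sum>i\<in>A. D i)"
  define \<Psi> where "\<Psi> = (\<Sum>i\<in>A. \<Sum>l\<in>A. (codeg i l)\<^sup>2 / D l)"
  define \<tau> where "\<tau> = 2 * \<Gamma>\<^sup>2 / L"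
  assume "\<not> ?thesis"
  then have less: "4 * \<Gamma>\<^sup>2 * \<Psi> < L * e" by (simp add: e_def \<Psi>_def)
  have lam: "0 < \<tau>" using L \<Gamma> by (simp add: \<tau>_def)
  have "L * card B \<le> (\<Sum>j\<in>B. \<Sum>i\<in>A. f i j)"
    using sum_mono[of B "\<lambda>_. L"] deg by (simp add: mult.commute)
  also have "\<dots> = e" unfolding e_def D_def by (rule sum.swap)
  finally have eL: "L * card B \<le> e" .
  moreover have "0 < card B" using B fin by (simp add: card_gt_0_iff)
  ultimately have e0: "0 < e" using L by (smt (verit) mult_pos_pos of_nat_0_less_iff)
  have "e / 2 < e - \<tau> * \<Psi>" using less L by (simp add: \<tau>_def field_simps)
  then have "sqrt \<tau> * e < 2 * sqrt \<tau> * (e - \<tau> * \<Psi>)" using lam by simp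
  also have "\<dots> \<le> \<Gamma> * sqrt (e * card B)"
    using factorization_energy[OF fin f01 fac lam] by (simp add: e_def \<Psi>_def D_def codeg_def)
  finally have "(sqrt \<tau> * e)\<^sup>2 < (\<Gamma> * sqrt (e * card B))\<^sup>2"
    using lam e0 by (intro power_strict_mono) auto
  then have "\<tau> * e\<^sup>2 < \<Gamma>\<^sup>2 * (e * card B)"
    using lam e0 by (simp add: power_mult_distrib)
  then have "2 * e < L * card B"
    using L \<Gamma> e0 by (simp add: \<tau>_def field_simps power2_eq_square)
  then show False using eL e0 by simp
qed

section \<open>All-ones blocks from dense neighbourhoods\<close>

definition ones_block :: "nat \<Rightarrow> nat set \<Rightarrow> nat set \<Rightarrow> (nat \<Rightarrow> nat \<Rightarrow> real) \<Rightarrow> bool" where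
  "ones_block t A B f \<longleftrightarrow> (\<exists>I J. I \<subseteq> A \<and> J \<subseteq> B \<and> card I = t \<and> card J = t \<and> (\<forall>i\<in>I. \<forall>j\<in>J. f i j = 1))"

lemma ones_block_mono:
  assumes "ones_block t A' B' f" "A' \<subseteq> A" "B' \<subseteq> B"
  shows "ones_block t A B f"
proof -
  obtain I J where "I \<subseteq> A'" "J \<subseteq> B'" "card I = t" "card J = t" "\<forall>i\<in>I. \<forall>j\<in>J. f i j = 1"
    using assms(1) unfolding ones_block_def by blast
  then show ?thesis
    using assms(2,3) unfolding ones_block_def
    by - (rule exI[of _ I], rule exI[of _ J], blast)
qed

lemma ones_block_transpose:
  assumes "ones_block t A B f"
  shows "ones_block t B A (\<lambda>j i. f i j)"
proof -
  obtain I J where "I \<subseteq> A" "J \<subseteq> B" "card I = t" "card J = t" "\<forall>i\<in>I. \<forall>j\<in>J. f i j = 1"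
    using assms(1) unfolding ones_block_def by blast
  then show ?thesis
    unfolding ones_block_def
    by - (rule exI[of _ J], rule exI[of _ I], blast)
qed

text \<open>A Kovari-Sos-Turan style pigeonhole. Counting ones shows that at least \<alpha>|C|/2
  columns meet at least t rows of R. Their neighbourhoods in R take at most 2^|R| values, so t of
  these columns share the same one.\<close>

lemma ones_block_of_dense_rows:
  fixes f :: "nat \<Rightarrow> nat \<Rightarrow> real" and \<alpha> :: real
  assumes fin: "finite R" "finite C"
    and f01: "\<And>i j. i \<in> R \<Longrightarrow> j \<in> C \<Longrightarrow> f i j \<in> {0, 1}"
    and dense: "\<And>i. i \<in> R \<Longrightarrow> \<alpha> * card C \<le> (\<Sum>j\<in>C. f i j)"
    and R: "2 * t \<le> \<alpha> * card R" "R \<noteq> {}" and C: "2 * t * 2 ^ card R \<le> \<alpha> * card C"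
  shows "ones_block t R C f"
proof -
  define nb where "nb j = {i \<in> R. f i j = 1}" for j
  define C' where "C' = {j \<in> C. t \<le> card (nb j)}"
  have fC': "finite C'" and subC: "C' \<subseteq> C" using fin unfolding C'_def by auto
  have R0: "0 < card R" using R fin by (simp add: card_gt_0_iff)
  have nbR: "card (nb j) \<le> card R" for j
    unfolding nb_def using fin by (intro card_mono) auto
  have deg: "(\<Sum>i\<in>R. f i j) = card (nb j)" if "j \<in> C" for j
  proof -
    have "(\<Sum>i\<in>R. f i j) = (\<Sum>i\<in>R. if f i j = 1 then 1 else 0)"
      using f01[OF _ that] by (intro sum.cong refl) force
    also have "\<dots> = card (nb j)"
      unfolding nb_def using fin by (simp flip: sum.inter_filter)
    finally show ?thesis .
  qed
  have "card R * (\<alpha> * card C) \<le> (\<Sum>i\<in>R. \<Sum>j\<in>C. f i j)"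
    using sum_mono[of R "\<lambda>_. \<alpha> * real (card C)", OF dense] by simp
  also have "\<dots> = (\<Sum>j\<in>C. real (card (nb j)))"
    by (subst sum.swap) (simp add: deg)
  \<comment> \<open>Columns outside C' have fewer than t ones each; the resulting loss t|C| is at
    most half of the lower bound |R| \<alpha> |C|.\<close>
  also have "\<dots> \<le> (\<Sum>j\<in>C. (if j \<in> C' then real (card R) else 0) + t)"
    using nbR by (intro sum_mono) (auto simp: C'_def intro: add_increasing2)
  also have "\<dots> = card R * card C' + t * card C"
  proof -
    have "C \<inter> C' = C'" using subC by auto
    then show ?thesis
      using fin by (simp add: sum.distrib mult.commute flip: sum.inter_restrict)
  qed
  finally have "card R * (\<alpha> * card C) \<le> card R * card C' + t * real (card C)" by simp
  moreover have "2 * (t * real (card C)) \<le> card R * (\<alpha> * card C)"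
    using mult_right_mono[OF R(1), of "card C"] by (simp add: mult_ac)
  ultimately have "card R * (\<alpha> * card C) \<le> card R * (2 * real (card C'))" by simp
  then have "\<alpha> * card C \<le> 2 * card C'" using R0 by (simp add: mult_le_cancel_left)
  then have "real (t * 2 ^ card R) \<le> real (card C')" using C by simp
  then have "t * card (Pow R) \<le> card C'"
    using fin by (simp only: of_nat_le_iff card_Pow)
  moreover obtain S where S: "S \<subseteq> R" "card C' \<le> card (nb -` {S} \<inter> C') * card (Pow R)"
    using pigeonhole_card[of nb C' "Pow R"] fin fC' by (auto simp: nb_def)
  ultimately have "t * card (Pow R) \<le> card (nb -` {S} \<inter> C') * card (Pow R)" by linarith
  then have tS: "t \<le> card (nb -` {S} \<inter> C')" using fin by (simp add: card_Pow)
  obtain J where J: "J \<subseteq> nb -` {S} \<inter> C'" "card J = t"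
    using obtain_subset_with_card_n[OF tS] by blast
  show ?thesis
  \<comment> \<open>A member of J is what shows |S| \<ge> t; J is empty only for t = 0, where the
    empty block serves.\<close>
  proof (cases "J = {}")
    case True
    then show ?thesis using J unfolding ones_block_def by (auto intro!: exI[of _ "{}"])
  next
    case False
    then obtain j where "j \<in> J" by blast
    then have "t \<le> card S" using J unfolding C'_def by auto
    then obtain I where I: "I \<subseteq> S" "card I = t"
      using obtain_subset_with_card_n by blast
    have "I \<subseteq> R" "J \<subseteq> C" using I S J subC by blast+
    moreover have "f i j = 1" if "i \<in> I" "j \<in> J" for i j
    proof -
      have "i \<in> nb j" using that I J by blast
      then show ?thesis by (simp add: nb_def)
    qed
    ultimately show ?thesis using I J unfolding ones_block_def by blast
  qed
qed

text \<open>Let C be the neighbourhood of l, of size D. The column degrees bound the sum of the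
  codegrees with l by 2LD, so rows of codegree below \<sigma>D/4 carry at most \<sigma>LD^2/2 of the
  energy. Each other row carries at most D^2, so more than \<sigma>L/2 rows have density at least
  \<sigma>/4 in C.\<close>

lemma ones_block_of_energetic_row:
  fixes f :: "nat \<Rightarrow> nat \<Rightarrow> real" and B :: "nat set" and \<sigma> L :: real
  defines "codeg \<equiv> \<lambda>i l. \<Sum>j\<in>B. f i j * f l j"
  assumes fin: "finite A" "finite B" and l: "l \<in> A"
    and f01: "\<And>i j. i \<in> A \<Longrightarrow> j \<in> B \<Longrightarrow> f i j \<in> {0, 1}"
    and D: "D = (\<Sum>j\<in>B. f l j)" and deg: "\<And>j. j \<in> B \<Longrightarrow> (\<Sum>i\<in>A. f i j) \<le> 2 * L"
    and energy: "\<sigma> * L * D\<^sup>2 < (\<Sum>i\<in>A. (codeg i l)\<^sup>2)"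
    and \<sigma>: "0 < \<sigma>" and L: "0 < L"
    and \<rho>: "8 * t \<le> \<sigma> * real \<rho>" "0 < \<rho>" "2 * \<rho> \<le> \<sigma> * L" and D0: "8 * t * 2 ^ \<rho> \<le> \<sigma> * D" "0 < D"
  shows "ones_block t A B f"
proof -
  define X where "X = {i \<in> A. \<sigma> / 4 * D \<le> codeg i l}"
  define C where "C = {j \<in> B. f l j = 1}"
  have XA: "X \<subseteq> A" and fX: "finite X" using fin by (auto simp: X_def)
  have codC: "codeg i l = (\<Sum>j\<in>C. f i j)" if "i \<in> A" for i
    unfolding codeg_def C_def using fin f01[OF l]
    by (subst sum.inter_filter) (force intro!: sum.cong)+
  have DC: "D = card C"
  proof -
    have "D = (\<Sum>j\<in>B. if f l j = 1 then 1 else 0)"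
      unfolding D using f01[OF l] by (intro sum.cong refl) force
    then show ?thesis unfolding C_def using fin by (simp flip: sum.inter_filter)
  qed
  have cod0: "0 \<le> codeg i l" and codD: "codeg i l \<le> D" if "i \<in> A" for i
  proof -
    show "0 \<le> codeg i l"
      unfolding codeg_def using f01[OF that] f01[OF l] by (intro sum_nonneg) force
    show "codeg i l \<le> D"
      unfolding codeg_def D using f01[OF that] f01[OF l] by (intro sum_mono) force
  qed
  have "(\<Sum>i\<in>A. codeg i l) = (\<Sum>j\<in>B. f l j * (\<Sum>i\<in>A. f i j))"
    unfolding codeg_def by (subst sum.swap) (simp add: sum_distrib_left mult.commute)
  also have "\<dots> \<le> (\<Sum>j\<in>B. f l j * (2 * L))"
    using f01[OF l] deg by (intro sum_mono mult_left_mono) force+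
  also have "\<dots> = 2 * L * D" unfolding D by (simp add: sum_distrib_left sum_distrib_right mult_ac)
  finally have total: "(\<Sum>i\<in>A. codeg i l) \<le> 2 * L * D" .
  have "(\<Sum>i\<in>A. (codeg i l)\<^sup>2) \<le> (\<Sum>i\<in>A. (if i \<in> X then D\<^sup>2 else 0) + \<sigma> / 4 * D * codeg i l)"
  proof (rule sum_mono)
    fix i assume i: "i \<in> A"
    show "(codeg i l)\<^sup>2 \<le> (if i \<in> X then D\<^sup>2 else 0) + \<sigma> / 4 * D * codeg i l"
    proof (cases "i \<in> X")
      case True
      have "(codeg i l)\<^sup>2 \<le> D\<^sup>2" using cod0[OF i] codD[OF i] by (intro power_mono) auto
      moreover have "0 \<le> \<sigma> / 4 * D * codeg i l" using \<sigma> D0 cod0[OF i] by simp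
      ultimately show ?thesis using True by simp
    next
      case False
      then have "codeg i l \<le> \<sigma> / 4 * D" using i by (simp add: X_def)
      from mult_right_mono[OF this cod0[OF i]] show ?thesis
        using False by (simp add: power2_eq_square)
    qed
  qed
  also have "\<dots> = card X * D\<^sup>2 + \<sigma> / 4 * D * (\<Sum>i\<in>A. codeg i l)"
  proof -
    have "A \<inter> X = X" using XA by auto
    then show ?thesis
      using fin by (simp add: sum.distrib sum_distrib_left flip: sum.inter_restrict)
  qed
  also have "\<dots> \<le> card X * D\<^sup>2 + \<sigma> / 4 * D * (2 * L * D)"
    using total \<sigma> D0 by (intro add_left_mono mult_left_mono) auto
  finally have "\<sigma> * L * D\<^sup>2 < (card X + \<sigma> * L / 2) * D\<^sup>2"
    using energy by (simp add: power2_eq_square algebra_simps)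
  then have "\<sigma> * L < card X + \<sigma> * L / 2" using D0 by (simp add: mult_less_cancel_right)
  then have "\<rho> \<le> card X" using \<rho>(3) by linarith
  \<comment> \<open>Only \<rho> rows are kept: the pigeonhole costs 2^|R|, which must not grow with
    L.\<close>
  then obtain R where R: "R \<subseteq> X" "card R = \<rho>"
    using obtain_subset_with_card_n by blast
  have "ones_block t R C f"
  proof (rule ones_block_of_dense_rows[where \<alpha> = "\<sigma> / 4"])
    show "finite R" using R fX finite_subset by blast
    show "finite C" using fin by (simp add: C_def)
    show "f i j \<in> {0, 1}" if "i \<in> R" "j \<in> C" for i j
      using that R XA f01 unfolding C_def by blast
    show "\<sigma> / 4 * card C \<le> (\<Sum>j\<in>C. f i j)" if "i \<in> R" for i
      using that R codC[of i] DC by (auto simp: X_def)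
    show "2 * real t \<le> \<sigma> / 4 * card R" using \<rho> R by simp
    show "R \<noteq> {}" using R \<rho> by auto
    show "2 * real t * 2 ^ card R \<le> \<sigma> / 4 * card C" using D0 DC R by simp
  qed
  then show ?thesis
    by (rule ones_block_mono) (use R XA in \<open>auto simp: C_def\<close>)
qed

text \<open>The energy bound is averaged over l. Rows of degree below D0 contribute at most 2 L D0
  each and are few compared with e, so some row of degree at least D0 must have energy above
  \<sigma> L D_l^2, and \<open>ones_block_of_energetic_row\<close> applies.\<close>

lemma ones_block_of_regular_columns:
  fixes \<Gamma> :: real and t :: nat
  assumes \<Gamma>: "0 < \<Gamma>" and t: "0 < t"
  shows "\<exists>\<eta>>0::real. \<exists>L0>0::real. \<forall>A B f L.
       finite A \<longrightarrow> finite B \<longrightarrow> B \<noteq> {} \<longrightarrow> (\<forall>i\<in>A. \<forall>j\<in>B. f i j \<in> {0, 1}) \<longrightarrow>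
       factors_within \<Gamma> A B f \<longrightarrow> L0 \<le> L \<longrightarrow> (\<forall>j\<in>B. L \<le> (\<Sum>i\<in>A. f i j) \<and> (\<Sum>i\<in>A. f i j) \<le> 2 * L) \<longrightarrow>
       real (card A) \<le> \<eta> * L * real (card B) \<longrightarrow>
       ones_block t A B f"
proof -
  \<comment> \<open>The value of \<eta> keeps the low-degree contribution at most 2\<sigma>Le, so
    the total without an energetic row is at most 3\<sigma>Le; \<sigma> makes 4\<Gamma>^2 *
    3\<sigma> = 3/4 < 1. The values of \<rho>, D0 and L0 meet the thresholds of
    \<open>ones_block_of_energetic_row\<close>.\<close>
  define \<sigma> where "\<sigma> = 1 / (16 * \<Gamma>\<^sup>2)"
  define \<rho> where "\<rho> = nat \<lceil>8 * t / \<sigma>\<rceil>"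
  define D0 where "D0 = 8 * t * 2 ^ \<rho> / \<sigma>"
  define \<eta> where "\<eta> = \<sigma> / D0"
  define L0 where "L0 = 2 * \<rho> / \<sigma>"
  have \<sigma>: "0 < \<sigma>" using \<Gamma> by (simp add: \<sigma>_def)
  have "8 * t / \<sigma> \<le> real \<rho>" unfolding \<rho>_def by linarith
  then have \<rho>: "8 * t \<le> \<sigma> * \<rho>" using \<sigma> by (simp add: field_simps)
  then have \<rho>0: "0 < \<rho>" using t by (cases "\<rho> = 0") auto
  have D00: "0 < D0" using t \<sigma> by (simp add: D0_def)
  show ?thesis
  proof (rule exI[of _ \<eta>], intro conjI exI[of _ L0] allI impI)
    show "0 < \<eta>" "0 < L0" using \<sigma> D00 \<rho>0 by (simp_all add: \<eta>_def L0_def)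
    fix A B :: "nat set" and f :: "nat \<Rightarrow> nat \<Rightarrow> real" and L :: real
    assume fin: "finite A" "finite B" and B: "B \<noteq> {}"
      and f01: "\<forall>i\<in>A. \<forall>j\<in>B. f i j \<in> {0, 1}" and fac: "factors_within \<Gamma> A B f"
      and L0: "L0 \<le> L" and deg: "\<forall>j\<in>B. L \<le> (\<Sum>i\<in>A. f i j) \<and> (\<Sum>i\<in>A. f i j) \<le> 2 * L"
      and card: "real (card A) \<le> \<eta> * L * real (card B)"
    have L: "0 < L" using L0 \<open>0 < L0\<close> by linarith
    define D where "D l = (\<Sum>j\<in>B. f l j)" for l
    define cod where "cod i l = (\<Sum>j\<in>B. f i j * f l j)" for i l
    define e where "e = (\<Sum>l\<in>A. D l)"
    have f01': "f i j \<in> {0, 1}" if "i \<in> A" "j \<in> B" for i j using f01 that by blast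
    have energy: "L * e \<le> 4 * \<Gamma>\<^sup>2 * (\<Sum>i\<in>A. \<Sum>l\<in>A. (cod i l)\<^sup>2 / D l)"
      unfolding e_def D_def cod_def
      by (rule codegree_energy_ge[OF fin B f01' fac \<Gamma> L]) (use deg in auto)
    have "L * card B \<le> (\<Sum>j\<in>B. \<Sum>i\<in>A. f i j)"
      using sum_mono[of B "\<lambda>_. L"] deg by (simp add: mult.commute)
    also have "\<dots> = e" unfolding e_def D_def by (rule sum.swap)
    finally have eL: "L * card B \<le> e" .
    moreover have "0 < L * card B" using B fin L by (simp add: card_gt_0_iff)
    ultimately have e0: "0 < e" by linarith
    have Dnn: "0 \<le> D l" if "l \<in> A" for l
      unfolding D_def using f01'[OF that] by (intro sum_nonneg) force
    have cod0: "0 \<le> cod i l" and codD: "cod i l \<le> D l" if "i \<in> A" "l \<in> A" for i l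
    proof -
      show "0 \<le> cod i l"
        unfolding cod_def using f01'[OF that(1)] f01'[OF that(2)] by (intro sum_nonneg) force
      show "cod i l \<le> D l"
        unfolding cod_def D_def using f01'[OF that(1)] f01'[OF that(2)] by (intro sum_mono) force
    qed
    have codsum: "(\<Sum>i\<in>A. cod i l) \<le> 2 * L * D l" if l: "l \<in> A" for l
    proof -
      have "(\<Sum>i\<in>A. cod i l) = (\<Sum>j\<in>B. f l j * (\<Sum>i\<in>A. f i j))"
        unfolding cod_def by (subst sum.swap) (simp add: sum_distrib_left mult.commute)
      also have "\<dots> \<le> (\<Sum>j\<in>B. f l j * (2 * L))"
        using f01'[OF l] deg by (intro sum_mono mult_left_mono) force+
      finally show ?thesis by (simp add: D_def sum_distrib_left sum_distrib_right mult_ac)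
    qed
    have "\<exists>l\<in>A. D0 \<le> D l \<and> \<sigma> * L * (D l)\<^sup>2 < (\<Sum>i\<in>A. (cod i l)\<^sup>2)"
    proof (rule ccontr)
      assume no: "\<not> ?thesis"
      have bound: "(\<Sum>i\<in>A. (cod i l)\<^sup>2 / D l) \<le> \<sigma> * L * D l + 2 * L * D0" if l: "l \<in> A" for l
      proof (cases "D0 \<le> D l")
        case True
        then have "(\<Sum>i\<in>A. (cod i l)\<^sup>2) \<le> \<sigma> * L * (D l)\<^sup>2" using no l by force
        then have "(\<Sum>i\<in>A. (cod i l)\<^sup>2) / D l \<le> \<sigma> * L * D l"
          using True D00 by (simp add: divide_le_eq power2_eq_square mult.assoc)
        moreover have "0 \<le> 2 * L * D0" using L D00 by simp
        ultimately show ?thesis unfolding sum_divide_distrib by linarith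
      next
        case False
        have "(\<Sum>i\<in>A. (cod i l)\<^sup>2 / D l) \<le> (\<Sum>i\<in>A. cod i l)"
        proof (rule sum_mono)
          fix i assume i: "i \<in> A"
          \<comment> \<open>This follows from codeg(i,l) \<le> D_l; for an empty row l the quotient
            is 0 by the convention for division by zero.\<close>
          show "(cod i l)\<^sup>2 / D l \<le> cod i l"
            using mult_left_mono[OF codD[OF i l] cod0[OF i l]] cod0[OF i l] Dnn[OF l]
            by (cases "D l = 0") (simp_all add: divide_le_eq power2_eq_square)
        qed
        also have "\<dots> \<le> 2 * L * D l" by (rule codsum[OF l])
        also have "\<dots> \<le> 2 * L * D0" using False L by (intro mult_left_mono) auto
        finally show ?thesis using \<sigma> L Dnn[OF l] by (simp add: add_increasing)
      qed
      have "(\<Sum>i\<in>A. \<Sum>l\<in>A. (cod i l)\<^sup>2 / D l) = (\<Sum>l\<in>A. \<Sum>i\<in>A. (cod i l)\<^sup>2 / D l)"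
        by (rule sum.swap)
      also have "\<dots> \<le> (\<Sum>l\<in>A. \<sigma> * L * D l + 2 * L * D0)"
        by (intro sum_mono bound)
      also have "\<dots> = \<sigma> * L * e + 2 * L * D0 * card A"
        by (simp add: e_def sum.distrib sum_distrib_left)
      also have "\<dots> \<le> \<sigma> * L * e + 2 * L * D0 * (\<eta> * (L * card B))"
        using card L D00 by (intro add_left_mono mult_left_mono) (auto simp: mult.assoc)
      also have "\<dots> \<le> \<sigma> * L * e + 2 * L * D0 * (\<eta> * e)"
        using eL L D00 \<open>0 < \<eta>\<close> by (intro add_left_mono mult_left_mono) auto
      also have "\<dots> = 3 * \<sigma> * L * e" using D00 by (simp add: \<eta>_def)
      finally have "4 * \<Gamma>\<^sup>2 * (\<Sum>i\<in>A. \<Sum>l\<in>A. (cod i l)\<^sup>2 / D l) \<le> 4 * \<Gamma>\<^sup>2 * (3 * \<sigma> * L * e)"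
        using \<Gamma> by (intro mult_left_mono) auto
      also have "\<dots> = 3 / 4 * (L * e)" using \<Gamma> by (simp add: \<sigma>_def)
      finally have "L * e \<le> 3 / 4 * (L * e)" using energy by linarith
      moreover have "0 < L * e" using L e0 by simp
      ultimately show False by linarith
    qed
    then obtain l where l: "l \<in> A" "D0 \<le> D l" "\<sigma> * L * (D l)\<^sup>2 < (\<Sum>i\<in>A. (cod i l)\<^sup>2)" by blast
    have "2 * \<rho> \<le> \<sigma> * L" using L0 \<sigma> by (simp add: L0_def field_simps)
    moreover have "8 * t * 2 ^ \<rho> \<le> \<sigma> * D l" using l(2) \<sigma> by (simp add: D0_def field_simps)
    ultimately show "ones_block t A B f"
      using fin l f01' deg \<sigma> L \<rho> \<rho>0 D00
      by (intro ones_block_of_energetic_row[where l = l and D = "D l" and L = L and \<rho> = \<rho> and \<sigma> = \<sigma>])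
         (auto simp: cod_def D_def)
  qed
qed

section \<open>Dyadic degree classes and deletion of low-degree vertices\<close>

text \<open>If every level failed, level l would have fewer than (a/(\<eta>d)) 2^(-l) elements. The
  geometric sum is then below 2a/(\<eta>d) \<le> a, while the levels cover B, which has at least a
  elements.\<close>

lemma popular_dyadic_level:
  fixes deg :: "nat \<Rightarrow> real" and d \<eta> a :: real
  assumes fin: "finite B" and B: "B \<noteq> {}" and a: "0 < a" "a \<le> card B"
    and deg: "\<And>j. j \<in> B \<Longrightarrow> d \<le> deg j" and d: "0 < d" and \<eta>: "0 < \<eta>" "2 \<le> \<eta> * d"
  obtains L where "d \<le> L" "a \<le> \<eta> * L * card {j \<in> B. L \<le> deg j \<and> deg j \<le> 2 * L}"
proof -
  \<comment> \<open>Neighbouring levels overlap at their endpoints, which is harmless since only a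
    cover of B is used.\<close>
  define lev where "lev l = {j \<in> B. 2 ^ l * d \<le> deg j \<and> deg j \<le> 2 * (2 ^ l * d)}" for l :: nat
  have ex: "\<exists>l. j \<in> lev l" if j: "j \<in> B" for j
  proof -
    obtain q :: nat where "deg j / d < 2 ^ q"
      using real_arch_pow[of 2] by auto
    then have "\<exists>q::nat. deg j \<le> 2 ^ q * d" using d by (intro exI[of _ q]) (simp add: field_simps)
    \<comment> \<open>With q minimal, j lies in level q - 1; for q = 0 the lower bound d on the
      degree puts j in level 0.\<close>
    then obtain q where q: "deg j \<le> 2 ^ q * d" "\<And>p. p < q \<Longrightarrow> \<not> deg j \<le> 2 ^ p * d"
      using exists_least_iff[of "\<lambda>q. deg j \<le> 2 ^ q * d"] by blast
    show ?thesis
    proof (cases q)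
      case 0
      then show ?thesis using q deg[OF j] d j by (intro exI[of _ 0]) (auto simp: lev_def)
    next
      case (Suc p)
      then show ?thesis using q(1) q(2)[of p] j by (intro exI[of _ p]) (auto simp: lev_def)
    qed
  qed
  then obtain h where h: "\<And>j. j \<in> B \<Longrightarrow> j \<in> lev (h j)" by metis
  obtain k where k: "h ` B \<subseteq> {..<k}" using fin finite_nat_bounded by (meson finite_imageI)
  have "\<exists>l. a \<le> \<eta> * (2 ^ l * d) * card (lev l)"
  proof (rule ccontr)
    assume "\<not> ?thesis"
    then have small: "\<eta> * (2 ^ l * d) * card (lev l) < a" for l by (simp add: not_le)
    have c: "card (lev l) \<le> a / (\<eta> * d) * (1 / 2) ^ l" for l
      using small[of l] \<eta> d by (simp add: field_simps)
    have "B \<subseteq> (\<Union>l<k. lev l)" using h k by blast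
    then have "card B \<le> card (\<Union>l<k. lev l)"
      using fin by (intro card_mono) (auto simp: lev_def)
    also have "\<dots> \<le> (\<Sum>l<k. card (lev l))" by (rule card_UN_le) simp
    finally have "real (card B) \<le> (\<Sum>l<k. real (card (lev l)))"
      by (metis of_nat_le_iff of_nat_sum)
    also have "\<dots> \<le> (\<Sum>l<k. a / (\<eta> * d) * (1 / 2) ^ l)" by (intro sum_mono c)
    also have "\<dots> = a / (\<eta> * d) * (2 * (1 - (1 / 2) ^ k))"
      by (subst sum_distrib_left[symmetric], subst sum_gp_strict) simp
    also have "\<dots> < a / (\<eta> * d) * 2" using a \<eta> d by (intro mult_strict_left_mono) auto
    also have "\<dots> \<le> a" using a \<eta> d by (simp add: field_simps)
    finally show False using a by simp
  qed
  then obtain l where "a \<le> \<eta> * (2 ^ l * d) * card (lev l)" by blast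
  moreover have "d \<le> 2 ^ l * d" using d by simp
  ultimately show ?thesis using that[of "2 ^ l * d"] by (simp add: lev_def)
qed

text \<open>\<open>popular_dyadic_level\<close> with a = |A| selects columns of degrees in [L, 2L],
  numerous enough that |A| \<le> \<eta> L |B'|. This is where |A| \<le> |B| enters; all rows are
  kept, so the degrees of the selected columns do not change.\<close>

lemma ones_block_of_large_column_degrees:
  fixes \<Gamma> :: real and t :: nat
  assumes \<Gamma>: "0 < \<Gamma>" and t: "0 < t"
  shows "\<exists>d>0::real. \<forall>A B f.
       finite A \<longrightarrow> finite B \<longrightarrow> B \<noteq> {} \<longrightarrow> card A \<le> card B \<longrightarrow> (\<forall>i\<in>A. \<forall>j\<in>B. f i j \<in> {0, 1}) \<longrightarrow>
       factors_within \<Gamma> A B f \<longrightarrow> (\<forall>j\<in>B. d \<le> (\<Sum>i\<in>A. f i j)) \<longrightarrow>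
       ones_block t A B f"
proof -
  obtain \<eta> L0 :: real where \<eta>: "0 < \<eta>" and L0: "0 < L0" and
    reg: "\<forall>A B f L. finite A \<longrightarrow> finite B \<longrightarrow> B \<noteq> {} \<longrightarrow> (\<forall>i\<in>A. \<forall>j\<in>B. f i j \<in> {0, 1}) \<longrightarrow>
       factors_within \<Gamma> A B f \<longrightarrow> L0 \<le> L \<longrightarrow> (\<forall>j\<in>B. L \<le> (\<Sum>i\<in>A. f i j) \<and> (\<Sum>i\<in>A. f i j) \<le> 2 * L) \<longrightarrow>
       real (card A) \<le> \<eta> * L * real (card B) \<longrightarrow>
       ones_block t A B f"
    using ones_block_of_regular_columns[OF \<Gamma> t] by blast
  \<comment> \<open>L0 serves the regular case for every L \<ge> d, and 2/\<eta> makes the geometric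
    sum at most a.\<close>
  define d where "d = max L0 (2 / \<eta>)"
  have d: "0 < d" "L0 \<le> d" "2 \<le> \<eta> * d"
    using L0 \<eta> by (auto simp: d_def max_def field_simps)
  show ?thesis
  proof (intro exI[of _ d] conjI allI impI)
    show "0 < d" by (rule d(1))
    fix A B :: "nat set" and f :: "nat \<Rightarrow> nat \<Rightarrow> real"
    assume fin: "finite A" "finite B" and B: "B \<noteq> {}" and le: "card A \<le> card B"
      and f01: "\<forall>i\<in>A. \<forall>j\<in>B. f i j \<in> {0, 1}" and fac: "factors_within \<Gamma> A B f"
      and deg: "\<forall>j\<in>B. d \<le> (\<Sum>i\<in>A. f i j)"
    have "A \<noteq> {}" using B deg d by auto
    then have A0: "0 < card A" using fin by (simp add: card_gt_0_iff)
    obtain L where L: "d \<le> L"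
      "card A \<le> \<eta> * L * card {j \<in> B. L \<le> (\<Sum>i\<in>A. f i j) \<and> (\<Sum>i\<in>A. f i j) \<le> 2 * L}"
      using popular_dyadic_level[OF fin(2) B, of "card A" d "\<lambda>j. \<Sum>i\<in>A. f i j" \<eta>] A0 le deg d \<eta>
      by auto
    let ?B = "{j \<in> B. L \<le> (\<Sum>i\<in>A. f i j) \<and> (\<Sum>i\<in>A. f i j) \<le> 2 * L}"
    have "?B \<noteq> {}"
    proof
      assume "?B = {}"
      then show False using L(2) A0 by (simp only: card.empty)
    qed
    then have "ones_block t A ?B f"
      using fin f01 factors_within_subset[OF fac order_refl, of ?B] L d
      by (intro reg[rule_format, of A ?B f L]) auto
    then show "ones_block t A B f" by (rule ones_block_mono) auto
  qed
qed

text \<open>Induction on |A| + |B|. Deleting a vertex of degree below d loses fewer than d ones and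
  lowers d(|A| + |B|) by exactly d, so the hypothesis survives. Deletions are made on the larger
  side; once all its degrees reach d, \<open>ones_block_of_large_column_degrees\<close>
  finishes.\<close>

lemma ones_block_of_many_ones:
  fixes \<Gamma> :: real and t :: nat
  assumes \<Gamma>: "0 < \<Gamma>" and t: "0 < t"
  shows "\<exists>d>0::real. \<forall>A B f.
       finite A \<longrightarrow> finite B \<longrightarrow> (\<forall>i\<in>A. \<forall>j\<in>B. f i j \<in> {0, 1}) \<longrightarrow>
       factors_within \<Gamma> A B f \<longrightarrow> d * real (card A + card B) < (\<Sum>i\<in>A. \<Sum>j\<in>B. f i j) \<longrightarrow>
       ones_block t A B f"
proof -
  obtain d :: real where d: "0 < d" and
    cols: "\<forall>A B f. finite A \<longrightarrow> finite B \<longrightarrow> B \<noteq> {} \<longrightarrow> card A \<le> card B \<longrightarrow> (\<forall>i\<in>A. \<forall>j\<in>B. f i j \<in> {0, 1}) \<longrightarrow>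
       factors_within \<Gamma> A B f \<longrightarrow> (\<forall>j\<in>B. d \<le> (\<Sum>i\<in>A. f i j)) \<longrightarrow>
       ones_block t A B f"
    using ones_block_of_large_column_degrees[OF \<Gamma> t] by blast
  have "ones_block t A B f"
    if "finite A" "finite B" "\<forall>i\<in>A. \<forall>j\<in>B. f i j \<in> {0, 1}"
      "factors_within \<Gamma> A B f" "d * real (card A + card B) < (\<Sum>i\<in>A. \<Sum>j\<in>B. f i j)" for A B f
    using that
  proof (induction "card A + card B" arbitrary: A B f rule: less_induct)
    case less
    note fin = less.prems(1,2) and f01 = less.prems(3) and fac = less.prems(4) and many = less.prems(5)
    \<comment> \<open>An empty side would make the number of ones 0, which cannot exceed a
      nonnegative bound.\<close>
    have ne: "A \<noteq> {}" "B \<noteq> {}" using many d by (auto simp: mult_less_0_iff)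
    \<comment> \<open>Stated for arbitrary data with the induction hypothesis as a premise, so that
      it serves both f and its transpose, according to which side is larger.\<close>
    have step: "ones_block t A B f"
      if A: "finite A" "finite B" "\<forall>i\<in>A. \<forall>j\<in>B. f i j \<in> {0, 1}" "factors_within \<Gamma> A B f"
        and m: "d * real (card A + card B) < (\<Sum>i\<in>A. \<Sum>j\<in>B. f i j)" and le: "card A \<le> card B" and "B \<noteq> {}"
        and IH: "\<And>B'. B' \<subset> B \<Longrightarrow> d * (card A + card B') < (\<Sum>i\<in>A. \<Sum>j\<in>B'. f i j) \<Longrightarrow> ones_block t A B' f"
      for A B f
    proof (cases "\<forall>j\<in>B. d \<le> (\<Sum>i\<in>A. f i j)")
      case True
      show ?thesis by (rule cols[rule_format]) (use A le \<open>B \<noteq> {}\<close> True in auto)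
    next
      case False
      then obtain j where j: "j \<in> B" "(\<Sum>i\<in>A. f i j) < d" by (auto simp: not_le)
      have "(\<Sum>i\<in>A. \<Sum>j\<in>B. f i j) = (\<Sum>i\<in>A. f i j + (\<Sum>j\<in>B - {j}. f i j))"
        by (intro sum.cong refl sum.remove A j)
      also have "\<dots> = (\<Sum>i\<in>A. f i j) + (\<Sum>i\<in>A. \<Sum>j\<in>B - {j}. f i j)"
        by (rule sum.distrib)
      finally have "(\<Sum>i\<in>A. \<Sum>j\<in>B. f i j) = (\<Sum>i\<in>A. f i j) + (\<Sum>i\<in>A. \<Sum>j\<in>B - {j}. f i j)" .
      moreover have "real (card B) = card (B - {j}) + 1"
        by (simp only: card.remove[OF A(2) j(1)] of_nat_Suc)
      ultimately have "d * (card A + card (B - {j})) < (\<Sum>i\<in>A. \<Sum>j\<in>B - {j}. f i j)"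
        using m j(2) by (simp only: of_nat_add distrib_left)
      with IH[of "B - {j}"] j(1) have "ones_block t A (B - {j}) f" by auto
      then show ?thesis by (rule ones_block_mono) auto
    qed
    show ?case
    proof (cases "card A \<le> card B")
      case True
      show ?thesis
      proof (rule step[OF fin f01 fac many True ne(2)])
        fix B' assume B': "B' \<subset> B" and m: "d * (card A + card B') < (\<Sum>i\<in>A. \<Sum>j\<in>B'. f i j)"
        have "card B' < card B" using B' fin by (simp add: psubset_card_mono)
        then show "ones_block t A B' f"
          using B' m fin f01 factors_within_subset[OF fac order_refl, of B']
          by (intro less.hyps) (auto dest: finite_subset)
      qed
    next
      case False
      have "ones_block t B A (\<lambda>j i. f i j)"
      proof (rule step)
        show "finite B" "finite A" "A \<noteq> {}" "card B \<le> card A" using fin ne False by auto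
        show "\<forall>j\<in>B. \<forall>i\<in>A. f i j \<in> {0, 1}" using f01 by blast
        show "factors_within \<Gamma> B A (\<lambda>j i. f i j)" by (rule factors_within_transpose[OF fac])
        show "d * (card B + card A) < (\<Sum>j\<in>B. \<Sum>i\<in>A. f i j)"
          using many by (subst sum.swap) (simp add: add.commute)
        fix A' assume A': "A' \<subset> A" and m: "d * (card B + card A') < (\<Sum>j\<in>B. \<Sum>i\<in>A'. f i j)"
        have "card A' < card A" using A' fin by (simp add: psubset_card_mono)
        moreover have "d * (card A' + card B) < (\<Sum>i\<in>A'. \<Sum>j\<in>B. f i j)"
          using m by (subst sum.swap) (simp add: add.commute)
        ultimately have "ones_block t A' B f"
          using A' fin f01 factors_within_subset[OF fac, of A' B]
          by (intro less.hyps) (auto dest: finite_subset)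
        then show "ones_block t B A' (\<lambda>j i. f i j)" by (rule ones_block_transpose)
      qed
      from ones_block_transpose[OF this] show ?thesis .
    qed
  qed
  with d show ?thesis by (intro exI[of _ d]) auto
qed

section \<open>Translation between matrices and index sets\<close>

text \<open>The strict inequality lets an actual factorization be extracted from the infimum.
  Positive dimensions make its row and column norms nonnegative, as the witnesses a and b have to
  be.\<close>

lemma factors_within_gamma2:
  assumes M: "M \<in> carrier_mat m n" and mn: "0 < m" "0 < n" and less: "gamma2 M < \<Gamma>"
  shows "factors_within \<Gamma> {..<m} {..<n} (\<lambda>i j. M $$ (i, j))"
proof -
  have "\<exists>x \<in> {row_norm U * col_norm V | U V k.
     U \<in> carrier_mat (dim_row M) k \<and> V \<in> carrier_mat k (dim_col M) \<and> U * V = M}. x < \<Gamma>"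
    using cInf_lessD[OF gamma2_set_nonempty less[unfolded gamma2_def]] by blast
  then obtain U V k where U: "U \<in> carrier_mat m k" and V: "V \<in> carrier_mat k n" and UV: "U * V = M"
    and x: "row_norm U * col_norm V < \<Gamma>"
    using M by auto
  have rU: "(\<Sum>c<k. (U $$ (i, c))\<^sup>2) \<le> (row_norm U)\<^sup>2" if "i < m" for i
  proof -
    have "L2_set (\<lambda>c. U $$ (i, c)) {..<k} \<le> row_norm U"
      unfolding row_norm_def using U that by (intro Max_ge) auto
    then have "(L2_set (\<lambda>c. U $$ (i, c)) {..<k})\<^sup>2 \<le> (row_norm U)\<^sup>2"
      by (intro power_mono L2_set_nonneg)
    then show ?thesis by (simp add: L2_set_def sum_nonneg)
  qed
  have cV: "(\<Sum>c<k. (V $$ (c, j))\<^sup>2) \<le> (col_norm V)\<^sup>2" if "j < n" for j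
  proof -
    have "L2_set (\<lambda>c. V $$ (c, j)) {..<k} \<le> col_norm V"
      unfolding col_norm_def using V that by (intro Max_ge) auto
    then have "(L2_set (\<lambda>c. V $$ (c, j)) {..<k})\<^sup>2 \<le> (col_norm V)\<^sup>2"
      by (intro power_mono L2_set_nonneg)
    then show ?thesis by (simp add: L2_set_def sum_nonneg)
  qed
  have prod: "M $$ (i, j) = (\<Sum>c<k. U $$ (i, c) * V $$ (c, j))" if "i < m" "j < n" for i j
    unfolding UV[symmetric] using U V that by (simp add: scalar_prod_def atLeast0LessThan)
  show ?thesis
    unfolding factors_within_def
    by (rule exI[of _ "row_norm U"], rule exI[of _ "col_norm V"], rule exI[of _ k],
        rule exI[of _ "\<lambda>i c. U $$ (i, c)"], rule exI[of _ "\<lambda>c j. V $$ (c, j)"])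
       (use U V mn x rU cV prod row_norm_nonneg[of U] col_norm_nonneg[of V] in auto)
qed

lemma has_ones_submatrix_of_ones_block:
  assumes M: "M \<in> carrier_mat m n" and blk: "ones_block t {..<m} {..<n} (\<lambda>i j. M $$ (i, j))"
  shows "has_ones_submatrix t M"
proof -
  obtain I J where IJ: "I \<subseteq> {..<m}" "J \<subseteq> {..<n}" "card I = t" "card J = t"
    and one: "\<And>i j. i \<in> I \<Longrightarrow> j \<in> J \<Longrightarrow> M $$ (i, j) = 1"
    using blk unfolding ones_block_def by blast
  \<comment> \<open>The cardinalities of these sets are the dimensions of the submatrix, and its
    entries are read off at \<open>pick I\<close> and \<open>pick J\<close>, which stay inside I and
    J.\<close>
  have "{i. i < m \<and> i \<in> I} = I" "{j. j < n \<and> j \<in> J} = J" using IJ by auto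
  then have "submatrix M I J = ones_mat t t"
    unfolding submatrix_def ones_mat_def
    using M IJ pick_in_set_le[of _ I] pick_in_set_le[of _ J]
    by (intro cong_mat) (auto intro!: one)
  then show ?thesis
    using M IJ unfolding has_ones_submatrix_def by auto
qed

lemma sum_boolean_mat:
  assumes M: "M \<in> carrier_mat m n" and bool: "boolean_mat M"
  shows "\<forall>i\<in>{..<m}. \<forall>j\<in>{..<n}. M $$ (i, j) \<in> {0, 1}"
    and "(\<Sum>i<m. \<Sum>j<n. M $$ (i, j)) = num_ones M"
proof -
  show f01: "\<forall>i\<in>{..<m}. \<forall>j\<in>{..<n}. M $$ (i, j) \<in> {0, 1}"
    using M bool unfolding boolean_mat_def elements_mat_def by fastforce
  have "{(i, j). i < dim_row M \<and> j < dim_col M \<and> M $$ (i, j) = 1}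
      = {p \<in> {..<m} \<times> {..<n}. M $$ p = 1}"
    using M by auto
  then have "real (num_ones M) = (\<Sum>p\<in>{..<m} \<times> {..<n}. if M $$ p = 1 then 1 else 0)"
    unfolding num_ones_def by (simp flip: sum.inter_filter)
  also have "\<dots> = (\<Sum>p\<in>{..<m} \<times> {..<n}. M $$ p)"
    using f01 by (intro sum.cong refl) force
  finally show "(\<Sum>i<m. \<Sum>j<n. M $$ (i, j)) = num_ones M"
    by (simp add: sum.cartesian_product case_prod_beta)
qed

theorem theorem1p2:
  fixes t :: nat and \<gamma> :: real
  assumes "t \<ge> 2" and "\<gamma> > 0"
  shows "\<exists>d::real. \<forall>m n. \<forall>M \<in> carrier_mat m n.
           m > 0 \<longrightarrow> n > 0 \<longrightarrow> boolean_mat M \<longrightarrow> \<not> has_ones_submatrix t M \<longrightarrow> gamma2 M \<le> \<gamma> \<longrightarrow>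
           real (num_ones M) \<le> d * real (m + n)"
proof -
  \<comment> \<open>The slack 1 turns the bound \<gamma>_2(M) \<le> \<gamma> into the strict one
    that \<open>factors_within_gamma2\<close> asks for.\<close>
  have pos: "0 < \<gamma> + 1" "0 < t" using assms by auto
  obtain d :: real where d: "\<forall>A B f.
       finite A \<longrightarrow> finite B \<longrightarrow> (\<forall>i\<in>A. \<forall>j\<in>B. f i j \<in> {0, 1}) \<longrightarrow>
       factors_within (\<gamma> + 1) A B f \<longrightarrow> d * real (card A + card B) < (\<Sum>i\<in>A. \<Sum>j\<in>B. f i j) \<longrightarrow>
       ones_block t A B f"
    using ones_block_of_many_ones[OF pos] by blast
  show ?thesis
  proof (intro exI[of _ d] allI ballI impI)
    fix m n and M :: "real mat"
    assume M: "M \<in> carrier_mat m n" and mn: "0 < m" "0 < n" and bool: "boolean_mat M"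
      and free: "\<not> has_ones_submatrix t M" and \<gamma>: "gamma2 M \<le> \<gamma>"
    show "real (num_ones M) \<le> d * real (m + n)"
    proof (rule ccontr)
      assume "\<not> ?thesis"
      then have "d * real (card {..<m} + card {..<n}) < (\<Sum>i<m. \<Sum>j<n. M $$ (i, j))"
        by (simp add: sum_boolean_mat(2)[OF M bool])
      then have "ones_block t {..<m} {..<n} (\<lambda>i j. M $$ (i, j))"
        using d[rule_format, of "{..<m}" "{..<n}" "\<lambda>i j. M $$ (i, j)"]
          sum_boolean_mat(1)[OF M bool] factors_within_gamma2[OF M mn] \<gamma> by auto
      then show False using has_ones_submatrix_of_ones_block[OF M] free by blast
    qed
  qed
qed

end
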